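(* Let $X$ and $Y$ be metric spaces and let $f\colon X\to Y$ be a continuous function. Then the little Lipschitz derivative $\operatorname{lip} f\colon X\to[0,+\infty]$ is an $\mathcal{F}_\sigma$-lower semicontinuous function.
   Context: The metric on a metric space $X$ is written $|\cdot-\cdot|_X$, and $B(x,r)=\{u\in X: |u-x|_X<r\}$. For a function $f\colon X\to Y$ between metric spaces and $x\in X$, the little Lipschitz derivative is $\operatorname{lip} f(x)=\liminf_{r\to0^+}\ \sup_{u\in B(x,r)}\frac1r|f(u)-f(x)|_Y\in[0,+\infty]$. Let $\mathcal{F}_\sigma$ denote the family of all $F_\sigma$-subsets of $X$ (countable unions of closed sets). A function $g\colon X\to\overline{\mathbb{R}}=[-\infty,+\infty]$ is $\mathcal{F}_\sigma$-lower semicontinuous if $g^{-1}((\gamma,+\infty])\in\mathcal{F}_\sigma$ for every $\gamma\in\mathbb{R}$. *)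

theory Defs
  imports "HOL-Analysis.Analysis"
begin

text \<open>The little Lipschitz derivative. The lower limit is a lower limit of functions of the real
  radius \<open>r > 0\<close>; the centre \<open>u = x\<close> is included in the supremum, so the supremum is over a
  nonempty set of nonnegative numbers for every such \<open>r\<close>.\<close>

definition little_lip :: "('a::metric_space \<Rightarrow> 'b::metric_space) \<Rightarrow> 'a \<Rightarrow> ereal" where
  "little_lip f x = Liminf (at_right 0) (\<lambda>r::real. SUP u\<in>ball x r. ereal (1 / r * dist (f u) (f x)))"

lemma little_lip_nonneg: "0 \<le> little_lip f x"
  unfolding little_lip_def
proof (rule Liminf_bounded)
  show "\<forall>\<^sub>F r::real in at_right 0. 0 \<le> (SUP u\<in>ball x r. ereal (1 / r * dist (f u) (f x)))"
    using eventually_at_right_less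
  proof (rule eventually_mono)
    fix r :: real assume "0 < r"
    then show "0 \<le> (SUP u\<in>ball x r. ereal (1 / r * dist (f u) (f x)))"
      by (intro SUP_upper2[of x]) auto
  qed
qed

definition Fsigma_lower_semicontinuous :: "('a::topological_space \<Rightarrow> ereal) \<Rightarrow> bool" where
  "Fsigma_lower_semicontinuous g \<longleftrightarrow> (\<forall>\<gamma>::real. fsigma (g -` {ereal \<gamma><..}))"

end

theory Submission
  imports Defs
begin

text \<open>The condition \<open>little_lip f x > \<gamma>\<close> holds iff, for some \<open>c > \<gamma>\<close> and \<open>\<delta> > 0\<close>, the quotient
  supremum over \<open>ball x r\<close> is at least \<open>c\<close> for all \<open>r < \<delta>\<close>. For a fixed radius this is not a closed
  condition in \<open>x\<close>; required for all radii below \<open>\<delta>\<close> simultaneously, it is, since a slightly smaller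
  ball around a nearby point lies in \<open>ball x r\<close>. Countably many pairs \<open>c, \<delta>\<close> suffice.\<close>

definition uniform_growth_set ::
    "('a::metric_space \<Rightarrow> 'b::metric_space) \<Rightarrow> real \<Rightarrow> real \<Rightarrow> 'a set" where
  "uniform_growth_set f c \<delta> =
    {x. \<forall>r. 0 < r \<and> r < \<delta> \<longrightarrow> (\<forall>t<c * r. \<exists>u\<in>ball x r. t < dist (f u) (f x))}"

text \<open>A limit point \<open>x\<close> inherits the condition at radius \<open>r\<close> from a
  nearby member \<open>y\<close> at a slightly smaller radius \<open>s\<close>. Continuity at
  \<open>x\<close> controls the cost of replacing \<open>f y\<close> by \<open>f x\<close>.\<close>

lemma closed_uniform_growth_set:
  fixes f :: "'a::metric_space \<Rightarrow> 'b::metric_space"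
  assumes "continuous_on UNIV f"
  shows "closed (uniform_growth_set f c \<delta>)"
proof -
  have "x \<in> uniform_growth_set f c \<delta>" if x: "x \<in> closure (uniform_growth_set f c \<delta>)" for x
    unfolding uniform_growth_set_def
  proof safe
    fix r t :: real
    assume r: "0 < r" "r < \<delta>" and t: "t < c * r"
    \<comment> \<open>The strict inequality \<open>t < c * r\<close> leaves room to shrink the
      radius. Taking a limit from the left avoids a case split on the sign of
      \<open>c\<close>.\<close>
    have "((\<lambda>s. c * s) \<longlongrightarrow> c * r) (at_left r)"
      by (intro tendsto_intros)
    then have "\<forall>\<^sub>F s in at_left r. t < c * s"
      using t by (rule order_tendstoD)
    moreover have "\<forall>\<^sub>F s in at_left r. 0 < s \<and> s < r"
      using r(1) by (auto simp: eventually_at_left_field)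
    ultimately have "\<forall>\<^sub>F s in at_left r. t < c * s \<and> 0 < s \<and> s < r"
      by (rule eventually_conj)
    then obtain s where s: "t < c * s" "0 < s" "s < r"
      using eventually_happens[of _ "at_left r"] by fastforce
    \<comment> \<open>The slack \<open>t' - t\<close> is reserved for the change from
      \<open>f y\<close> to \<open>f x\<close>.\<close>
    obtain t' where t': "t < t'" "t' < c * s"
      using dense[OF s(1)] by blast
    have "isCont f x"
      using assms by (simp add: continuous_on_eq_continuous_at)
    then obtain d where d: "d > 0" "\<And>y. dist y x < d \<Longrightarrow> dist (f y) (f x) < t' - t"
      using t'(1) unfolding continuous_at_eps_delta by (meson diff_gt_0_iff_gt)
    \<comment> \<open>The bound \<open>r - s\<close> puts \<open>ball y s\<close> inside
      \<open>ball x r\<close>.\<close>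
    obtain y where y: "y \<in> uniform_growth_set f c \<delta>" "dist y x < min d (r - s)"
      using x d(1) s(3) unfolding closure_approachable by (metis diff_gt_0_iff_gt min_less_iff_conj)
    obtain u where u: "dist y u < s" "t' < dist (f u) (f y)"
      using y(1) s r t'(2) unfolding uniform_growth_set_def by force
    have "dist x u < r"
      using u(1) y(2) dist_triangle[of x u y] by (simp add: dist_commute)
    moreover have "t < dist (f u) (f x)"
      using u(2) d(2)[of y] y(2) dist_triangle[of "f u" "f y" "f x"] by (simp add: dist_commute)
    ultimately show "\<exists>u\<in>ball x r. t < dist (f u) (f x)"
      by auto
  qed
  then show ?thesis
    by (metis closure_subset closure_closed closed_closure subsetI subset_antisym)
qed

lemma uniform_growth_set_imp_le_little_lip:
  assumes "x \<in> uniform_growth_set f c \<delta>" "0 < \<delta>"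
  shows "ereal c \<le> little_lip f x"
  unfolding little_lip_def
proof (rule Liminf_bounded)
  have "\<forall>\<^sub>F r in at_right 0. 0 < r \<and> r < \<delta>"
    using assms(2) by (auto simp: eventually_at_right_field)
  then show "\<forall>\<^sub>F r in at_right 0. ereal c \<le> (SUP u\<in>ball x r. ereal (1 / r * dist (f u) (f x)))"
  proof (rule eventually_mono)
    fix r :: real
    assume r: "0 < r \<and> r < \<delta>"
    show "ereal c \<le> (SUP u\<in>ball x r. ereal (1 / r * dist (f u) (f x)))"
      \<comment> \<open>Testing the supremum from below by every smaller value matches the
        quantifier over \<open>t\<close> in \<open>uniform_growth_set\<close>.\<close>
      unfolding le_SUP_iff
    proof safe
      fix z assume "z < ereal c"
      \<comment> \<open>Here \<open>z\<close> may be minus infinity, so a real number above it is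
        scaled by \<open>r\<close> instead.\<close>
      then obtain z' where z': "z < ereal z'" "z' < c"
        by (metis ereal_dense2 less_ereal.simps(1))
      from z'(2) r have "z' * r < c * r"
        by simp
      then obtain u where "u \<in> ball x r" "z' * r < dist (f u) (f x)"
        using assms(1) r unfolding uniform_growth_set_def by blast
      then show "\<exists>u\<in>ball x r. z < ereal (1 / r * dist (f u) (f x))"
        using r z'(1)
        by (intro bexI[of _ u]) (auto simp: field_simps intro: less_trans[of z "ereal z'"])
    qed
  qed
qed

text \<open>A strict lower bound on a lower limit leaves a positive gap above \<gamma> on some
  interval of radii. One index \<open>n\<close> measures both gap and interval, since shrinking
  either parameter only weakens the condition. Conversely, the gap restores the strictness lost in
  the lower limit.\<close>

lemma less_little_lip_iff:
  "ereal \<gamma> < little_lip f x \<longleftrightarrow>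
    (\<exists>n. x \<in> uniform_growth_set f (\<gamma> + inverse (real (Suc n))) (inverse (real (Suc n))))"
proof
  assume "ereal \<gamma> < little_lip f x"
  then obtain z where z: "\<gamma> < z" "ereal z < little_lip f x"
    by (metis ereal_dense2 less_ereal.simps(1))
  have "\<forall>\<^sub>F r in at_right 0. ereal z < (SUP u\<in>ball x r. ereal (1 / r * dist (f u) (f x)))"
    using z(2) unfolding little_lip_def by (rule less_LiminfD)
  then obtain b where b: "b > 0"
    "\<And>r. 0 < r \<Longrightarrow> r < b \<Longrightarrow> ereal z < (SUP u\<in>ball x r. ereal (1 / r * dist (f u) (f x)))"
    unfolding eventually_at_right_field by blast
  obtain n where n: "inverse (real (Suc n)) < min b (z - \<gamma>)"
    using reals_Archimedean[of "min b (z - \<gamma>)"] b(1) z(1) by auto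
  have "x \<in> uniform_growth_set f (\<gamma> + inverse (real (Suc n))) (inverse (real (Suc n)))"
    unfolding uniform_growth_set_def
  proof safe
    fix r t :: real
    assume r: "0 < r" "r < inverse (real (Suc n))" and t: "t < (\<gamma> + inverse (real (Suc n))) * r"
    have "r < b"
      using r(2) n by linarith
    then obtain u where u: "u \<in> ball x r" "z < 1 / r * dist (f u) (f x)"
      using b(2)[OF r(1)] unfolding less_SUP_iff by auto
    have "(\<gamma> + inverse (real (Suc n))) * r \<le> z * r"
      using n r(1) by (intro mult_right_mono) linarith+
    with t have "t < z * r"
      by linarith
    also have "z * r < dist (f u) (f x)"
      using u(2) r(1) by (simp add: field_simps)
    finally show "\<exists>u\<in>ball x r. t < dist (f u) (f x)"
      using u(1) by blast
  qed
  then show "\<exists>n. x \<in> uniform_growth_set f (\<gamma> + inverse (real (Suc n))) (inverse (real (Suc n)))" ..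
next
  assume "\<exists>n. x \<in> uniform_growth_set f (\<gamma> + inverse (real (Suc n))) (inverse (real (Suc n)))"
  then obtain n where "ereal (\<gamma> + inverse (real (Suc n))) \<le> little_lip f x"
    using uniform_growth_set_imp_le_little_lip by (metis inverse_positive_iff_positive of_nat_0_less_iff zero_less_Suc)
  moreover have "ereal \<gamma> < ereal (\<gamma> + inverse (real (Suc n)))"
    by simp
  ultimately show "ereal \<gamma> < little_lip f x"
    by (rule less_le_trans[rotated])
qed

theorem theorem5p2:
  fixes f :: "'a::metric_space \<Rightarrow> 'b::metric_space"
  assumes "continuous_on UNIV f"
  shows "Fsigma_lower_semicontinuous (little_lip f)"
  unfolding Fsigma_lower_semicontinuous_def
proof
  fix \<gamma> :: real
  have "little_lip f -` {ereal \<gamma><..} =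
      (\<Union>n. uniform_growth_set f (\<gamma> + inverse (real (Suc n))) (inverse (real (Suc n))))"
    by (auto simp: less_little_lip_iff simp del: of_nat_Suc)
  \<comment> \<open>Continuity of \<open>f\<close> enters here, through the closedness of each
    member of the union.\<close>
  then show "fsigma (little_lip f -` {ereal \<gamma><..})"
    using closed_uniform_growth_set[OF assms] by (auto intro: fsigma.intros)
qed

end
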